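(* Let $I$ be a finite set, $\Theta$ a parameter set, and let $f=(f_i)_{i\in I}$ and $g=(g_i)_{i\in I}$ be two parametric models over $I$ with parameter $\theta\in\Theta$. Let $\mathbf 2$ denote the one-parameter model over $\{0,1\}$ that sends $\lambda\in[0,1]$ to $(\lambda,1-\lambda)$. Then the mixture $\operatorname{Mixt}(f,g)$ can be constructed from $f$, $g$ and $\mathbf 2$ by a chain of Markov combinations and aggregates as follows: $$\bigl((f\times\mathbf 2)_{M_1}\star(g\times\mathbf 2)_{M_2}\bigr)_{M_4}=(\lambda f_i+(1-\lambda)g_i\mid i\in I)=\operatorname{Mixt}(f,g),$$ where the category mappings are the following, with $*$ an element not in $I$: - $f\times\mathbf 2$ and $g\times\mathbf 2$ are the Markov combinations over $I\times\{0,1\}$ with respect to the constant maps $I\to\{\bullet\}$ and $\{0,1\}\to\{\bullet\}$, i.e. they have entries $(\lambda f_i,(1-\lambda)f_i\mid i\in I)$ and $(\lambda g_i,(1-\lambda)g_i\mid i\in I)$; - $M_1=I\sqcup\{*\}$ with $I\times\{0,1\}\to M_1$, $(i,0)\mapsto i$, $(i,1)\mapsto *$; - $M_2=\{*\}\sqcup I$ with $I\times\{0,1\}\to M_2$, $(i,0)\mapsto *$, $(i,1)\mapsto i$; - the combination $\star$ is taken with respect to the mappings to $M_3=\{0,1\}$ given by $M_1\to M_3$, $i\mapsto0$, $*\mapsto1$, and $M_2\to M_3$, $*\mapsto0$, $i\mapsto1$, with respect to which $(f\times\mathbf 2)_{M_1}$ and $(g\times\mathbf 2)_{M_2}$ are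 meta-consistent; - $M_4=I$ with $M_1\times_{M_3}M_2\to M_4$, $(i,* )\mapsto i$, $( *,i)\mapsto i$.
   Context: A parametric model over a finite set $X$ with parameter set $\Psi$ is a family of functions $f_x:\Psi\to\mathbb R_{\ge0}$ $(x\in X)$ with $\sum_x f_x=1$ identically. All models in the statement are regarded as models with parameter $(\theta,\lambda)\in\Theta\times[0,1]$. The mixture $\operatorname{Mixt}(f,g)$ is the model $(\lambda f_i+(1-\lambda)g_i)_{i\in I}$, where $\lambda\in[0,1]$ is an additional parameter. A category mapping of a finite set $X$ is a surjection $p:X\to M$ onto a finite set. The aggregate of a model $f$ over $X$ with respect to $p$ is the model $f_M$ over $M$ with $f_{M,k}=\sum_{x:\,p(x)=k}f_x$. For category mappings $p:X\to M$, $q:Y\to M$, the mapping product is $X\times_M Y=\{(x,y):p(x)=q(y)\}$. Models $f$ over $X$ and $g$ over $Y$ with the same parameter set are meta-consistent if $f_M=g_M$ for all parameter values; their (meta-)Markov combination is the model $f\star g$ over $X\times_M Y$ given by $(f\star g)_{x,y}=f_xg_y/f_{M,p(x)}$, where a quotient with zero denominator is interpreted as $0$. *)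

theory Defs
  imports Complex_Main
begin

(* A family (f_x) of real functions on a parameter set is a total HOL function
   'x => 'p => real; only its values for x and parameters in the carrier sets matter. *)

definition param_model :: "'x set \<Rightarrow> 'p set \<Rightarrow> ('x \<Rightarrow> 'p \<Rightarrow> real) \<Rightarrow> bool" where
  "param_model X \<Psi> f \<longleftrightarrow>
     finite X \<and> (\<forall>\<psi>\<in>\<Psi>. (\<forall>x\<in>X. 0 \<le> f x \<psi>) \<and> (\<Sum>x\<in>X. f x \<psi>) = 1)"

definition category_mapping :: "'x set \<Rightarrow> 'm set \<Rightarrow> ('x \<Rightarrow> 'm) \<Rightarrow> bool" where
  "category_mapping X M p \<longleftrightarrow> finite X \<and> finite M \<and> p ` X = M"

definition aggregate ::
    "'x set \<Rightarrow> ('x \<Rightarrow> 'm) \<Rightarrow> ('x \<Rightarrow> 'p \<Rightarrow> real) \<Rightarrow> 'm \<Rightarrow> 'p \<Rightarrow> real" where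
  "aggregate X p f k \<psi> = (\<Sum>x\<in>{x\<in>X. p x = k}. f x \<psi>)"

definition mapping_product ::
    "'x set \<Rightarrow> 'y set \<Rightarrow> ('x \<Rightarrow> 'm) \<Rightarrow> ('y \<Rightarrow> 'm) \<Rightarrow> ('x \<times> 'y) set" where
  "mapping_product X Y p q = {(x, y). x \<in> X \<and> y \<in> Y \<and> p x = q y}"

definition meta_consistent ::
    "'p set \<Rightarrow> 'x set \<Rightarrow> 'y set \<Rightarrow> 'm set \<Rightarrow> ('x \<Rightarrow> 'm) \<Rightarrow> ('y \<Rightarrow> 'm) \<Rightarrow>
     ('x \<Rightarrow> 'p \<Rightarrow> real) \<Rightarrow> ('y \<Rightarrow> 'p \<Rightarrow> real) \<Rightarrow> bool" where
  "meta_consistent \<Psi> X Y M p q f g \<longleftrightarrow>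
     param_model X \<Psi> f \<and> param_model Y \<Psi> g \<and>
     category_mapping X M p \<and> category_mapping Y M q \<and>
     (\<forall>k\<in>M. \<forall>\<psi>\<in>\<Psi>. aggregate X p f k \<psi> = aggregate Y q g k \<psi>)"

(* Only the aggregate of f enters, so Y and q are not arguments; the result is meaningful on
   mapping_product X Y p q. Division by zero in HOL yields 0, as the convention requires. *)
definition markov_comb ::
    "'x set \<Rightarrow> ('x \<Rightarrow> 'm) \<Rightarrow> ('x \<Rightarrow> 'p \<Rightarrow> real) \<Rightarrow> ('y \<Rightarrow> 'p \<Rightarrow> real) \<Rightarrow>
     'x \<times> 'y \<Rightarrow> 'p \<Rightarrow> real" where
  "markov_comb X p f g = (\<lambda>(x, y) \<psi>. f x \<psi> * g y \<psi> / aggregate X p f (p x) \<psi>)"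

(* A model in one of the two parameters, regarded as a model in the pair. *)

definition lift_fst :: "('x \<Rightarrow> 't \<Rightarrow> real) \<Rightarrow> 'x \<Rightarrow> 't \<times> real \<Rightarrow> real" where
  "lift_fst f x = (\<lambda>(\<theta>, l). f x \<theta>)"

definition lift_snd :: "('x \<Rightarrow> real \<Rightarrow> real) \<Rightarrow> 'x \<Rightarrow> 't \<times> real \<Rightarrow> real" where
  "lift_snd f x = (\<lambda>(\<theta>, l). f x l)"

definition mixture ::
    "('i \<Rightarrow> 't \<Rightarrow> real) \<Rightarrow> ('i \<Rightarrow> 't \<Rightarrow> real) \<Rightarrow> 'i \<Rightarrow> 't \<times> real \<Rightarrow> real" where
  "mixture f g i = (\<lambda>(\<theta>, l). l * f i \<theta> + (1 - l) * g i \<theta>)"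

definition two :: "nat \<Rightarrow> real \<Rightarrow> real" where
  "two k l = (if k = 0 then l else 1 - l)"

definition to_point :: "'a \<Rightarrow> unit" where
  "to_point x = ()"

definition times_two :: "'i set \<Rightarrow> ('i \<Rightarrow> 't \<Rightarrow> real) \<Rightarrow> 'i \<times> nat \<Rightarrow> 't \<times> real \<Rightarrow> real" where
  "times_two I f = markov_comb I to_point (lift_fst f) (lift_snd two)"

(* The point * outside I is None and i in I is Some i, so this set serves as both M1 and M2. *)
definition with_star :: "'i set \<Rightarrow> 'i option set" where
  "with_star I = insert None (Some ` I)"

definition to_M1 :: "'i \<times> nat \<Rightarrow> 'i option" where
  "to_M1 = (\<lambda>(i, k). if k = 0 then Some i else None)"

definition to_M2 :: "'i \<times> nat \<Rightarrow> 'i option" where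
  "to_M2 = (\<lambda>(i, k). if k = 0 then None else Some i)"

definition M1_to_M3 :: "'i option \<Rightarrow> nat" where
  "M1_to_M3 x = (case x of Some i \<Rightarrow> 0 | None \<Rightarrow> 1)"

definition M2_to_M3 :: "'i option \<Rightarrow> nat" where
  "M2_to_M3 y = (case y of None \<Rightarrow> 0 | Some i \<Rightarrow> 1)"

(* The mapping product of M1 and M2 over M3 contains only pairs of the two listed shapes. *)
definition to_M4 :: "'i option \<times> 'i option \<Rightarrow> 'i" where
  "to_M4 z = (case z of (Some i, None) \<Rightarrow> i | (None, Some i) \<Rightarrow> i | _ \<Rightarrow> undefined)"

end

theory Submission
  imports Defs
begin

text \<open>
  Over the point \<open>0\<close> of \<open>M\<^sub>3\<close> the first factor has the entries \<open>\<lambda> f\<^sub>i\<close> and the second the single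
  entry \<open>\<lambda>\<close>, which is also their common aggregate, so the combination just returns \<open>\<lambda> f\<^sub>i\<close>;
  symmetrically it returns \<open>(1 - \<lambda>) g\<^sub>i\<close> over the point \<open>1\<close>. The map to \<open>M\<^sub>4\<close> adds the two.
  If the common aggregate is \<open>0\<close>, then the numerator vanishes and so does the expected entry,
  which is why the convention for zero denominators does no harm.
\<close>

text \<open>The fibres of \<open>p\<close> over \<open>M\<close> partition \<open>X\<close>, so
  summing fibre by fibre regroups the total mass without changing it.\<close>

lemma param_model_aggregate:
  assumes "category_mapping X M p" "param_model X \<Psi> f"
  shows "param_model M \<Psi> (aggregate X p f)"
proof -
  have "(\<Sum>k\<in>M. aggregate X p f k \<psi>) = (\<Sum>x\<in>X. f x \<psi>)" for \<psi>
    unfolding aggregate_def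
    by (rule sum.group) (use assms(1) in \<open>auto simp: category_mapping_def\<close>)
  then show ?thesis
    using assms by (auto simp: param_model_def category_mapping_def aggregate_def intro!: sum_nonneg)
qed

lemma param_model_lift_fst:
  "param_model X \<Theta> f \<Longrightarrow> param_model X (\<Theta> \<times> L) (lift_fst f)"
  by (auto simp: param_model_def lift_fst_def)

lemma param_model_lift_snd_two: "param_model {0, 1} (\<Theta> \<times> {0..1}) (lift_snd two)"
  by (auto simp: param_model_def lift_snd_def two_def)

lemma category_mapping_to_point:
  "finite X \<Longrightarrow> X \<noteq> {} \<Longrightarrow> category_mapping X {()} to_point"
  by (auto simp: category_mapping_def to_point_def)

lemma aggregate_to_point:
  "param_model X \<Psi> f \<Longrightarrow> \<psi> \<in> \<Psi> \<Longrightarrow> aggregate X to_point f u \<psi> = 1"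
  by (simp add: aggregate_def param_model_def to_point_def)

text \<open>Over a single point both aggregates are the total mass 1, so any two models agree there;
  nonemptiness makes the constant maps surjective.\<close>

lemma meta_consistent_to_point:
  assumes "param_model X \<Psi> f" "param_model Y \<Psi> g" "X \<noteq> {}" "Y \<noteq> {}"
  shows "meta_consistent \<Psi> X Y {()} to_point to_point f g"
proof -
  have "finite X" "finite Y"
    using assms by (auto simp: param_model_def)
  then show ?thesis
    using assms by (simp add: meta_consistent_def category_mapping_to_point aggregate_to_point)
qed

lemma times_two_eq:
  assumes "param_model I \<Theta> f" "\<theta> \<in> \<Theta>"
  shows "times_two I f (i, k) (\<theta>, l) = two k l * f i \<theta>"
  \<comment> \<open>The denominator is the total mass of \<open>f\<close>, which is 1 at every real
    \<open>l\<close>; taking \<open>UNIV\<close> for the second parameter set avoids a bound on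
    \<open>l\<close>.\<close>
  using aggregate_to_point[OF param_model_lift_fst[OF assms(1), of UNIV], of "(\<theta>, l)"] assms(2)
  by (simp add: times_two_def markov_comb_def lift_fst_def lift_snd_def)

lemma param_model_times_two:
  assumes "param_model I \<Theta> f"
  shows "param_model (I \<times> {0, 1}) (\<Theta> \<times> {0..1}) (times_two I f)"
proof -
  \<comment> \<open>The weights \<open>l\<close> and \<open>1 - l\<close> add to 1 for every real
    \<open>l\<close>; only nonnegativity of the entries uses the interval.\<close>
  have "(\<Sum>x\<in>I \<times> {0, 1}. times_two I f x (\<theta>, l)) = 1" if "\<theta> \<in> \<Theta>" for \<theta> l
  proof -
    have "(\<Sum>x\<in>I \<times> {0, 1}. times_two I f x (\<theta>, l)) = (\<Sum>i\<in>I. \<Sum>k\<in>{0, 1}. two k l * f i \<theta>)"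
      by (simp add: sum.cartesian_product' times_two_eq[OF assms that])
    also have "\<dots> = (\<Sum>i\<in>I. f i \<theta>)"
      by (intro sum.cong) (auto simp: two_def algebra_simps)
    finally show ?thesis
      using assms that by (simp add: param_model_def)
  qed
  then show ?thesis
    using assms by (auto simp: param_model_def times_two_eq[OF assms] two_def)
qed

text \<open>The star is the image of the pairs \<open>(i, 1)\<close>, so surjectivity rests on
  \<open>I\<close> having an element.\<close>

lemma category_mapping_to_M1:
  assumes "finite I" "I \<noteq> {}"
  shows "category_mapping (I \<times> {0, 1}) (with_star I) to_M1"
  using assms by (force simp: category_mapping_def with_star_def to_M1_def image_iff)

lemma category_mapping_to_M2:
  assumes "finite I" "I \<noteq> {}"
  shows "category_mapping (I \<times> {0, 1}) (with_star I) to_M2"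
  using assms by (force simp: category_mapping_def with_star_def to_M2_def image_iff)

lemma category_mapping_M1_to_M3:
  assumes "finite I" "I \<noteq> {}"
  shows "category_mapping (with_star I) {0, 1} M1_to_M3"
  using assms by (auto simp: category_mapping_def with_star_def M1_to_M3_def image_iff)

lemma category_mapping_M2_to_M3:
  assumes "finite I" "I \<noteq> {}"
  shows "category_mapping (with_star I) {0, 1} M2_to_M3"
  using assms by (auto simp: category_mapping_def with_star_def M2_to_M3_def image_iff)

text \<open>Over each point of M3 one factor has a copy of \<open>I\<close> as its fibre and the
  other only the star, so the product is two disjoint copies of \<open>I\<close>.\<close>

lemma mapping_product_with_star:
  "mapping_product (with_star I) (with_star I) M1_to_M3 M2_to_M3 =
    (\<lambda>i. (Some i, None)) ` I \<union> (\<lambda>i. (None, Some i)) ` I"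
  by (auto simp: mapping_product_def with_star_def M1_to_M3_def M2_to_M3_def)

lemma category_mapping_to_M4:
  assumes "finite I"
  shows "category_mapping (mapping_product (with_star I) (with_star I) M1_to_M3 M2_to_M3) I to_M4"
  using assms
  by (auto simp: category_mapping_def mapping_product_with_star to_M4_def image_Un image_image)

lemma aggregate_to_M4:
  assumes "i \<in> I"
  shows "aggregate (mapping_product (with_star I) (with_star I) M1_to_M3 M2_to_M3) to_M4 h i \<psi> =
    h (Some i, None) \<psi> + h (None, Some i) \<psi>"
proof -
  \<comment> \<open>The fibre over \<open>i\<close> meets each of the two copies of \<open>I\<close>
    exactly once.\<close>
  have "{x \<in> mapping_product (with_star I) (with_star I) M1_to_M3 M2_to_M3. to_M4 x = i} =
      {(Some i, None), (None, Some i)}"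
    using assms by (auto simp: mapping_product_with_star to_M4_def)
  then show ?thesis
    by (simp add: aggregate_def)
qed

lemma aggregate_to_M1:
  assumes "param_model I \<Theta> f" "\<theta> \<in> \<Theta>"
  shows "i \<in> I \<Longrightarrow> aggregate (I \<times> {0, 1}) to_M1 (times_two I f) (Some i) (\<theta>, l) = l * f i \<theta>"
    and "aggregate (I \<times> {0, 1}) to_M1 (times_two I f) None (\<theta>, l) = 1 - l"
proof -
  show "aggregate (I \<times> {0, 1}) to_M1 (times_two I f) (Some i) (\<theta>, l) = l * f i \<theta>" if "i \<in> I"
  proof -
    have "{x \<in> I \<times> {0, 1}. to_M1 x = Some i} = {(i, 0)}"
      using that by (auto simp: to_M1_def split: if_splits)
    then show ?thesis
      by (simp add: aggregate_def times_two_eq[OF assms] two_def)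
  qed
  \<comment> \<open>The whole layer with second coordinate 1 merges into the star; with
    \<open>1 - l\<close> factored out, the remaining sum is the total mass of
    \<open>f\<close>.\<close>
  have "{x \<in> I \<times> {0, 1}. to_M1 x = None} = I \<times> {1}"
    by (auto simp: to_M1_def split: if_splits)
  then show "aggregate (I \<times> {0, 1}) to_M1 (times_two I f) None (\<theta>, l) = 1 - l"
    using assms
    by (simp add: aggregate_def sum.cartesian_product' times_two_eq[OF assms] two_def
        param_model_def flip: sum_distrib_left)
qed

lemma aggregate_to_M2:
  assumes "param_model I \<Theta> g" "\<theta> \<in> \<Theta>"
  shows "i \<in> I \<Longrightarrow> aggregate (I \<times> {0, 1}) to_M2 (times_two I g) (Some i) (\<theta>, l) = (1 - l) * g i \<theta>"
    and "aggregate (I \<times> {0, 1}) to_M2 (times_two I g) None (\<theta>, l) = l"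
proof -
  show "aggregate (I \<times> {0, 1}) to_M2 (times_two I g) (Some i) (\<theta>, l) = (1 - l) * g i \<theta>"
    if "i \<in> I"
  proof -
    have "{x \<in> I \<times> {0, 1}. to_M2 x = Some i} = {(i, 1)}"
      using that by (auto simp: to_M2_def split: if_splits)
    then show ?thesis
      by (simp add: aggregate_def times_two_eq[OF assms] two_def)
  qed
  have "{x \<in> I \<times> {0, 1}. to_M2 x = None} = I \<times> {0}"
    by (auto simp: to_M2_def split: if_splits)
  then show "aggregate (I \<times> {0, 1}) to_M2 (times_two I g) None (\<theta>, l) = l"
    using assms
    by (simp add: aggregate_def sum.cartesian_product' times_two_eq[OF assms] two_def
        param_model_def flip: sum_distrib_left)
qed

lemma aggregate_M1_to_M3:
  "aggregate (with_star I) M1_to_M3 h 0 \<psi> = (\<Sum>i\<in>I. h (Some i) \<psi>)"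
  "aggregate (with_star I) M1_to_M3 h 1 \<psi> = h None \<psi>"
proof -
  have "{x \<in> with_star I. M1_to_M3 x = 0} = Some ` I" "{x \<in> with_star I. M1_to_M3 x = 1} = {None}"
    by (auto simp: with_star_def M1_to_M3_def)
  then show "aggregate (with_star I) M1_to_M3 h 0 \<psi> = (\<Sum>i\<in>I. h (Some i) \<psi>)"
    "aggregate (with_star I) M1_to_M3 h 1 \<psi> = h None \<psi>"
    by (simp_all add: aggregate_def sum.reindex)
qed

lemma aggregate_M2_to_M3:
  "aggregate (with_star I) M2_to_M3 h 0 \<psi> = h None \<psi>"
  "aggregate (with_star I) M2_to_M3 h 1 \<psi> = (\<Sum>i\<in>I. h (Some i) \<psi>)"
proof -
  have "{x \<in> with_star I. M2_to_M3 x = 0} = {None}" "{x \<in> with_star I. M2_to_M3 x = 1} = Some ` I"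
    by (auto simp: with_star_def M2_to_M3_def)
  then show "aggregate (with_star I) M2_to_M3 h 0 \<psi> = h None \<psi>"
    "aggregate (with_star I) M2_to_M3 h 1 \<psi> = (\<Sum>i\<in>I. h (Some i) \<psi>)"
    by (simp_all add: aggregate_def sum.reindex)
qed

text \<open>The composite of \<open>to_M1\<close> and \<open>M1_to_M3\<close> is the second
  projection on \<open>I \<times> {0, 1}\<close>. Hence \<open>f\<close> is summed out and the
  entries of \<open>two\<close> come back.\<close>

lemma aggregate_to_M1_M3:
  assumes "param_model I \<Theta> f" "\<theta> \<in> \<Theta>"
  shows "aggregate (with_star I) M1_to_M3 (aggregate (I \<times> {0, 1}) to_M1 (times_two I f)) 0 (\<theta>, l) = l"
    and "aggregate (with_star I) M1_to_M3 (aggregate (I \<times> {0, 1}) to_M1 (times_two I f)) 1 (\<theta>, l)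
      = 1 - l"
  unfolding aggregate_M1_to_M3 using assms
  by (simp_all add: aggregate_to_M1[OF assms] param_model_def del: One_nat_def flip: sum_distrib_left)

lemma aggregate_to_M2_M3:
  assumes "param_model I \<Theta> g" "\<theta> \<in> \<Theta>"
  shows "aggregate (with_star I) M2_to_M3 (aggregate (I \<times> {0, 1}) to_M2 (times_two I g)) 0 (\<theta>, l) = l"
    and "aggregate (with_star I) M2_to_M3 (aggregate (I \<times> {0, 1}) to_M2 (times_two I g)) 1 (\<theta>, l)
      = 1 - l"
  unfolding aggregate_M2_to_M3 using assms
  by (simp_all add: aggregate_to_M2[OF assms] param_model_def del: One_nat_def flip: sum_distrib_left)

lemma markov_comb_with_star:
  fixes I f g
  defines "h \<equiv> markov_comb (with_star I) M1_to_M3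
    (aggregate (I \<times> {0, 1}) to_M1 (times_two I f))
    (aggregate (I \<times> {0, 1}) to_M2 (times_two I g))"
  assumes f: "param_model I \<Theta> f" and g: "param_model I \<Theta> g" and "i \<in> I" "\<theta> \<in> \<Theta>"
  shows "h (Some i, None) (\<theta>, l) = l * f i \<theta>"
    and "h (None, Some i) (\<theta>, l) = (1 - l) * g i \<theta>"
proof -
  \<comment> \<open>The first coordinate of a pair selects the denominator: \<open>l\<close> for
    \<open>(Some i, None)\<close> and \<open>1 - l\<close> for
    \<open>(None, Some i)\<close>.\<close>
  have "M1_to_M3 (Some i) = 0" "M1_to_M3 (None :: 'a option) = 1"
    by (simp_all add: M1_to_M3_def)
  then show "h (Some i, None) (\<theta>, l) = l * f i \<theta>" "h (None, Some i) (\<theta>, l) = (1 - l) * g i \<theta>"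
    using assms
    by (simp_all add: markov_comb_def aggregate_to_M1_M3[OF f] aggregate_to_M1[OF f] aggregate_to_M2[OF g]
        del: One_nat_def)
qed

text \<open>Both factors aggregate to \<open>two\<close> over M3, whatever \<open>f\<close> and
  \<open>g\<close> are, so the two models need no relation to each other.\<close>

lemma meta_consistent_with_star:
  assumes "I \<noteq> {}" and f: "param_model I \<Theta> f" and g: "param_model I \<Theta> g"
  shows "meta_consistent (\<Theta> \<times> {0..1}) (with_star I) (with_star I) {0, 1} M1_to_M3 M2_to_M3
    (aggregate (I \<times> {0, 1}) to_M1 (times_two I f))
    (aggregate (I \<times> {0, 1}) to_M2 (times_two I g))"
proof -
  have I: "finite I" "I \<noteq> {}"
    using assms by (auto simp: param_model_def)
  note models = param_model_aggregate[OF category_mapping_to_M1[OF I] param_model_times_two[OF f]]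
    param_model_aggregate[OF category_mapping_to_M2[OF I] param_model_times_two[OF g]]
  show ?thesis
    unfolding meta_consistent_def
    using models category_mapping_M1_to_M3[OF I] category_mapping_M2_to_M3[OF I]
      aggregate_to_M1_M3[OF f] aggregate_to_M2_M3[OF g]
    by (intro conjI) auto
qed

theorem proposition16:
  fixes I :: "'i set" and \<Theta> :: "'t set"
    and f g :: "'i \<Rightarrow> 't \<Rightarrow> real"
  assumes "finite I" and "I \<noteq> {}"
    and "param_model I \<Theta> f" and "param_model I \<Theta> g"
  shows
    "meta_consistent (\<Theta> \<times> {0..1}) I {0, 1} {()} to_point to_point (lift_fst f) (lift_snd two) \<and>
     meta_consistent (\<Theta> \<times> {0..1}) I {0, 1} {()} to_point to_point (lift_fst g) (lift_snd two) \<and>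
     mapping_product I {0, 1} to_point to_point = I \<times> {0, 1 :: nat} \<and>
     (\<forall>i\<in>I. \<forall>\<theta>\<in>\<Theta>. \<forall>l\<in>{0..1}.
       times_two I f (i, 0) (\<theta>, l) = l * f i \<theta> \<and> times_two I f (i, 1) (\<theta>, l) = (1 - l) * f i \<theta> \<and>
       times_two I g (i, 0) (\<theta>, l) = l * g i \<theta> \<and> times_two I g (i, 1) (\<theta>, l) = (1 - l) * g i \<theta>) \<and>
     category_mapping (I \<times> {0, 1}) (with_star I) to_M1 \<and>
     category_mapping (I \<times> {0, 1}) (with_star I) to_M2 \<and>
     meta_consistent (\<Theta> \<times> {0..1}) (with_star I) (with_star I) {0, 1} M1_to_M3 M2_to_M3
       (aggregate (I \<times> {0, 1}) to_M1 (times_two I f))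
       (aggregate (I \<times> {0, 1}) to_M2 (times_two I g)) \<and>
     category_mapping (mapping_product (with_star I) (with_star I) M1_to_M3 M2_to_M3) I to_M4 \<and>
     (\<forall>i\<in>I. \<forall>\<theta>\<in>\<Theta>. \<forall>l\<in>{0..1}.
       aggregate (mapping_product (with_star I) (with_star I) M1_to_M3 M2_to_M3) to_M4
         (markov_comb (with_star I) M1_to_M3
           (aggregate (I \<times> {0, 1}) to_M1 (times_two I f))
           (aggregate (I \<times> {0, 1}) to_M2 (times_two I g))) i (\<theta>, l)
         = l * f i \<theta> + (1 - l) * g i \<theta> \<and>
       l * f i \<theta> + (1 - l) * g i \<theta> = mixture f g i (\<theta>, l))"
proof (intro conjI ballI)
  show "mapping_product I {0, 1} to_point to_point = I \<times> {0, 1 :: nat}"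
    by (auto simp: mapping_product_def to_point_def)
\<comment> \<open>For the mixture equation, \<open>aggregate_to_M4\<close> leaves one entry from
  each copy of \<open>I\<close>, and \<open>markov_comb_with_star\<close> evaluates both.\<close>
qed (use assms in \<open>auto simp: two_def mixture_def times_two_eq aggregate_to_M4
        markov_comb_with_star[OF assms(3,4)] simp del: One_nat_def
      intro!: meta_consistent_to_point param_model_lift_fst param_model_lift_snd_two
        category_mapping_to_M1 category_mapping_to_M2 category_mapping_to_M4
        meta_consistent_with_star\<close>)

end
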